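(* For all indices $\mathbf{k}$ and $\mathbf{l}$, \[\zeta^{s,t,*}_{\widehat{\mathcal S}}(\mathbf{k}*\mathbf{l};T_1,T_2)=\zeta^{s,t,*}_{\widehat{\mathcal S}}(\mathbf{k};T_1,T_2)\,\zeta^{s,t,*}_{\widehat{\mathcal S}}(\mathbf{l};T_1,T_2)\quad\text{in }\mathcal Z[T_1,T_2][[s,t]].\] Consequently $\zeta^{s,t}_{\widehat{\mathcal S}}(\mathbf{k}*\mathbf{l})=\zeta^{s,t}_{\widehat{\mathcal S}}(\mathbf{k})\zeta^{s,t}_{\widehat{\mathcal S}}(\mathbf{l})$ in $(\mathcal Z/\zeta(2)\mathcal Z)[[s,t]]$.
   Context: $s,t,T,T_1,T_2$ are commuting indeterminates. Index notation: an index is a finite tuple $\mathbf{k}=(k_1,\dots,k_r)$ of positive integers ($r\ge0$; the empty index is $\varnothing$). Its depth is $\mathrm{dep}(\mathbf{k})=r$ and its weight is $\mathrm{wt}(\mathbf{k})=k_1+\cdots+k_r$. For $0\le i\le r$ put $\mathbf{k}_{[i]}=(k_1,\dots,k_i)$ and $\mathbf{k}^{[i]}=(k_{i+1},\dots,k_r)$, and let $\overleftarrow{\mathbf{k}}=(k_r,\dots,k_1)$. For tuples $\mathbf{k},\mathbf{l}$ of the same length $r$, $\mathbf{k}\oplus\mathbf{l}=(k_1+l_1,\dots,k_r+l_r)$ and $b\binom{\mathbf{k}}{\mathbf{l}}=\prod_{i=1}^r\binom{k_i+l_i-1}{l_i}$. An index is admissible if it is empty or $k_r\ge2$; then $\zeta(\mathbf{k})=\sum_{0<n_1<\cdots<n_r}n_1^{-k_1}\cdots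 n_r^{-k_r}$, $\zeta(\varnothing)=1$. $\mathcal Z$ is the $\mathbb Q$-algebra generated by all these values. Every map defined on indices is extended $\mathbb Q$-linearly to formal $\mathbb Q$-linear combinations of indices. Words: $\mathfrak H=\mathbb Q\langle e_0,e_1\rangle$ (noncommutative polynomials), $\mathfrak H^1=\mathbb Q+e_1\mathfrak H$, $\mathfrak H^0=\mathbb Q+e_1\mathfrak He_0$, and $e_{\mathbf{k}}=e_1e_0^{k_1-1}\cdots e_1e_0^{k_r-1}$ ($e_\varnothing=1$). The harmonic product $*$ on $\mathfrak H^1$ is the $\mathbb Q$-bilinear product with $1*w=w*1=w$ and $we_{(k)}*w'e_{(l)}=(we_{(k)}*w')e_{(l)}+(w*w'e_{(l)})e_{(k)}-(w*w')e_{(k+l)}$ for $w,w'\in\mathfrak H^1$, $k,l\ge1$. The harmonic product of formal linear combinations of indices is transported via the linear bijection $\mathbf{k}\mapsto(-1)^{\mathrm{dep}(\mathbf{k})}e_{\mathbf{k}}$ onto $\mathfrak H^1$. Regularized values: $Z:\mathfrak H^0\to\mathbb R$ is linear with $Z(e_{\mathbf k})=(-1)^{\mathrm{dep}(\mathbf k)}\zeta(\mathbf k)$ for admissible $\mathbf k$. $Z^*_T:\mathfrak H^1\to\mathbb R[T]$ is the unique $\mathbb Q$-algebra homomorphism for $*$ extending $Z$ with $Z^*_T(e_1)=-T$, and $\zeta^*(\mathbf{k};T)=(-1)^{\mathrm{dep}(\mathbf k)}Z^*_T(e_{\mathbf k})$. The shuffle-regularized $\zeta^{ш}(\mathbf k;T)$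 is defined the same way using the shuffle product. Shifted values: $\zeta^{t,\bullet}_{\mathrm{shift}}(\mathbf{k};T)=\sum_{\mathbf n\in\mathbb Z_{\ge0}^{\mathrm{dep}(\mathbf k)}}b\binom{\mathbf k}{\mathbf n}\zeta^{\bullet}(\mathbf k\oplus\mathbf n;T)(-t)^{\mathrm{wt}(\mathbf n)}$, and similarly with $t$ replaced by $s$ or by $-t$. $(s,t)$-adic SMZVs: for an index $\mathbf k$ of depth $r$ and $\bullet\in\{*,ш\}$, $\zeta^{s,t,\bullet}_{\widehat{\mathcal S}}(\mathbf k;T_1,T_2)=\sum_{i=0}^{r}(-1)^{\mathrm{wt}(\mathbf k^{[i]})}\zeta^{s,\bullet}_{\mathrm{shift}}(\mathbf k_{[i]};T_1)\,\zeta^{-t,\bullet}_{\mathrm{shift}}(\overleftarrow{\mathbf k^{[i]}};T_2)\in\mathcal Z[T_1,T_2][[s,t]]$. $\zeta^{s,t}_{\widehat{\mathcal S}}(\mathbf k)$ is the image of $\zeta^{s,t,\bullet}_{\widehat{\mathcal S}}(\mathbf k;T,T)$ in $(\mathcal Z/\zeta(2)\mathcal Z)[[s,t]]$; it is independent of $T$ and of $\bullet$. *)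

theory Defs
  imports "HOL-Analysis.Analysis"
    "HOL-Computational_Algebra.Polynomial"
    "HOL-Computational_Algebra.Formal_Power_Series"
begin

definition is_index :: "nat list \<Rightarrow> bool" where
  "is_index k \<longleftrightarrow> (\<forall>x\<in>set k. 0 < x)"

definition admissible :: "nat list \<Rightarrow> bool" where
  "admissible k \<longleftrightarrow> is_index k \<and> (k = [] \<or> 2 \<le> last k)"

definition wt :: "nat list \<Rightarrow> nat" where
  "wt k = sum_list k"

definition mzv :: "nat list \<Rightarrow> real" where
  "mzv k = infsum (\<lambda>n. \<Prod>i<length k. 1 / real (n ! i) ^ (k ! i))
     {n :: nat list. length n = length k \<and> sorted_wrt (<) n \<and> (\<forall>x\<in>set n. 0 < x)}"

text \<open>Formal Q-linear combinations are represented as lists of (coefficient, basis element).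
  The basis element for the word algebra H^1 indexed by k is e_k.
  Harmonic product of words e_k * e_l, computed on reversed indices
  (the paper's recursion acts on the last letter).\<close>

fun hprod_rev :: "nat list \<Rightarrow> nat list \<Rightarrow> (int \<times> nat list) list" where
  "hprod_rev [] l = [(1, l)]"
| "hprod_rev k [] = [(1, k)]"
| "hprod_rev (a # k) (b # l) =
     map (\<lambda>(c, m). (c, b # m)) (hprod_rev (a # k) l)
   @ map (\<lambda>(c, m). (c, a # m)) (hprod_rev k (b # l))
   @ map (\<lambda>(c, m). (- c, (a + b) # m)) (hprod_rev k l)"

definition hprod_word :: "nat list \<Rightarrow> nat list \<Rightarrow> (int \<times> nat list) list" where
  "hprod_word k l = map (\<lambda>(c, m). (c, rev m)) (hprod_rev (rev k) (rev l))"

text \<open>Harmonic product of indices, transported via k \<mapsto> (-1)^dep(k) e_k.\<close>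
definition hprod_idx :: "nat list \<Rightarrow> nat list \<Rightarrow> (int \<times> nat list) list" where
  "hprod_idx k l = map (\<lambda>(c, m). ((-1) ^ (length k + length l + length m) * c, m))
     (hprod_word k l)"

definition lin_ext :: "(nat list \<Rightarrow> 'a::ring_1) \<Rightarrow> (int \<times> nat list) list \<Rightarrow> 'a" where
  "lin_ext f xs = (\<Sum>(c, m)\<leftarrow>xs. of_int c * f m)"

text \<open>Z^*_T on the basis e_k of H^1 (values in R[T]): the unique algebra homomorphism for
  the harmonic product extending Z (Z(e_k) = (-1)^dep(k) zeta(k) for admissible k) with
  Z^*_T(e_1) = -T.  It is determined by its values on the basis; we normalise it to be 0
  on lists that are not indices.\<close>
definition Zstar_hom :: "(nat list \<Rightarrow> real poly) \<Rightarrow> bool" where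
  "Zstar_hom g \<longleftrightarrow>
     (\<forall>k l. is_index k \<longrightarrow> is_index l \<longrightarrow> lin_ext g (hprod_word k l) = g k * g l)
   \<and> (\<forall>k. admissible k \<longrightarrow> g k = [: (-1) ^ length k * mzv k :])
   \<and> g [1] = [: 0, -1 :]
   \<and> (\<forall>k. \<not> is_index k \<longrightarrow> g k = 0)"

definition ZstarT :: "nat list \<Rightarrow> real poly" where
  "ZstarT = (THE g. Zstar_hom g)"

definition zeta_star :: "nat list \<Rightarrow> real poly" where
  "zeta_star k = smult ((-1) ^ length k) (ZstarT k)"

definition bcoef :: "nat list \<Rightarrow> nat list \<Rightarrow> nat" where
  "bcoef k n = (\<Prod>i<length k. (k ! i + n ! i - 1) choose (n ! i))"

definition oplus :: "nat list \<Rightarrow> nat list \<Rightarrow> nat list" where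
  "oplus k n = map2 (+) k n"

text \<open>Shifted value zeta^{c X,*}_shift(k;T) as a power series in X with coefficients in R[T]:
  sum over n of b(k,n) zeta^*(k+n;T) (-c X)^wt(n).  With c = 1 this is the shift by s
  (X = s), with c = -1 the shift by -t (X = t).\<close>
definition shift_fps :: "real \<Rightarrow> nat list \<Rightarrow> real poly fps" where
  "shift_fps c k = Abs_fps (\<lambda>m.
     (\<Sum>n\<in>{n :: nat list. length n = length k \<and> wt n = m}.
        smult (real (bcoef k n) * (- c) ^ m) (zeta_star (oplus k n))))"

text \<open>The ambient ring R[T1,T2][[s,t]] is realised as ((real poly) poly) fps fps:
  outer fps variable t, inner fps variable s, outer poly variable T2, inner poly variable T1.\<close>
type_synonym ring_st = "real poly poly fps fps"

definition emb_s :: "real poly fps \<Rightarrow> ring_st" where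
  "emb_s A = fps_const (Abs_fps (\<lambda>n. [: fps_nth A n :]))"

definition emb_t :: "real poly fps \<Rightarrow> ring_st" where
  "emb_t B = Abs_fps (\<lambda>n. fps_const (map_poly (\<lambda>x. [: x :]) (fps_nth B n)))"

definition zeta_S_st :: "nat list \<Rightarrow> ring_st" where
  "zeta_S_st k = (\<Sum>i\<le>length k.
      (-1) ^ wt (drop i k) * emb_s (shift_fps 1 (take i k))
        * emb_t (shift_fps (-1) (rev (drop i k))))"

end

theory Submission
  imports Defs
begin

text \<open>Three operations preserve multiplicativity for the harmonic product: reversing the index,
  convolving two functions along deconcatenation, and the shift. The shift comes from the ring
  endomorphism sending \<open>y\<close> to \<open>y / (1 + c X y)\<close> on letters \<open>z\<^sub>k = y\<^sup>k\<close>, so that its multiplicativity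
  is Vandermonde's identity. Hence everything rests on the multiplicativity of \<open>\<zeta>\<^sup>*\<close>, that is, on the
  existence and uniqueness of the regularization. Truncated sums are multiplicative, and each one
  is a polynomial in the harmonic number \<open>H\<^sub>N\<close> up to an error smaller than every power of \<open>1 / H\<^sub>N\<close>;
  such a polynomial is unique, so it depends multiplicatively on the index. Both its existence and
  the uniqueness of the regularization follow by induction on the number of trailing
  entries equal to 1, because the product of \<open>w\<close> with the index \<open>(1)\<close> is a positive multiple of \<open>w\<close>
  with a further such entry, plus indices with fewer of them.\<close>

subsection \<open>The harmonic product\<close>

text \<open>\<open>qsh f k l\<close> evaluates the linear extension of \<open>f\<close> at the harmonic product of the indices \<open>k\<close>
  and \<open>l\<close>, with the recursion on first instead of last letters.\<close>
fun qsh :: "(nat list \<Rightarrow> 'a::comm_ring_1) \<Rightarrow> nat list \<Rightarrow> nat list \<Rightarrow> 'a" where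
  "qsh f [] l = f l"
| "qsh f (a # k) [] = f (a # k)"
| "qsh f (a # k) (b # l) =
     qsh (\<lambda>m. f (b # m)) (a # k) l + qsh (\<lambda>m. f (a # m)) k (b # l)
   + qsh (\<lambda>m. f ((a + b) # m)) k l"

lemma qsh_Nil_right [simp]: "qsh f k [] = f k"
  by (cases k) auto

lemma qsh_add: "qsh (\<lambda>m. f m + g m) k l = qsh f k l + qsh g k l"
proof (induction f k l arbitrary: g rule: qsh.induct)
  case (3 f a k b l)
  show ?case unfolding qsh.simps 3 by (simp add: algebra_simps)
qed auto

lemma qsh_cmult: "qsh (\<lambda>m. c * f m) k l = c * qsh f k l"
  by (induction f k l rule: qsh.induct) (auto simp: algebra_simps)

lemma qsh_zero [simp]: "qsh (\<lambda>m. 0) k l = 0"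
  using qsh_cmult[of 0 "\<lambda>m. 0" k l] by simp

lemma qsh_commute: "qsh f k l = qsh f l k"
  by (induction f k l rule: qsh.induct) (auto simp: algebra_simps)

lemma qsh_hom:
  assumes "\<And>x y. \<phi> (x + y) = \<phi> x + \<phi> y"
  shows "qsh (\<lambda>m. \<phi> (f m)) k l = \<phi> (qsh f k l)"
  by (induction f k l rule: qsh.induct) (auto simp: assms)

text \<open>Merging letters only adds them, so a weight that turns sums of letters into products
  takes one and the same value on every term of the product of \<open>k\<close> and
  \<open>l\<close>.\<close>

lemma qsh_weight:
  assumes "\<And>x y. u (x + y) = u x * u y"
  shows "qsh (\<lambda>m. prod_list (map u m) * f m) k l =
    prod_list (map u k) * prod_list (map u l) * qsh f k l"
  by (induction f k l rule: qsh.induct) (auto simp: algebra_simps assms qsh_cmult)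

lemma qsh_snoc_single:
  "qsh f [a] (l @ [b]) = qsh (\<lambda>m. f (m @ [b])) [a] l + f (l @ [b, a]) + f (l @ [a + b])"
  by (induction l arbitrary: f) (auto simp: algebra_simps)

text \<open>Peeling off last letters obeys the same recursion as peeling off first ones. Invariance
  under reversal follows from this.\<close>

lemma qsh_snoc:
  "qsh f (k @ [a]) (l @ [b]) = qsh (\<lambda>m. f (m @ [b])) (k @ [a]) l
     + qsh (\<lambda>m. f (m @ [a])) k (l @ [b]) + qsh (\<lambda>m. f (m @ [a + b])) k l"
proof (induction f k l rule: qsh.induct)
  case (1 f l)
  then show ?case by (simp add: qsh_snoc_single)
next
  case (2 f c k)
  show ?case
    using qsh_snoc_single[of f b "c # k" a]
    by (simp add: qsh_commute[of _ _ "[b]"] algebra_simps)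
qed (auto simp: algebra_simps)

lemma qsh_rev: "qsh (\<lambda>m. f (rev m)) (rev k) (rev l) = qsh f k l"
  by (induction f k l rule: qsh.induct) (auto simp: qsh_snoc)

section \<open>From formal linear combinations to \<open>qsh\<close>\<close>

lemma lin_ext_simps:
  "lin_ext f [] = 0" "lin_ext f (x # xs) = of_int (fst x) * f (snd x) + lin_ext f xs"
  "lin_ext f (xs @ ys) = lin_ext f xs + lin_ext f ys"
  by (auto simp: lin_ext_def split: prod.split)

lemma lin_ext_map:
  "lin_ext f (map (\<lambda>(c, m). (c, h m)) xs) = lin_ext (\<lambda>m. f (h m)) xs"
  "lin_ext f (map (\<lambda>(c, m). (- c, h m)) xs) = - lin_ext (\<lambda>m. f (h m)) xs"
  by (induction xs) (auto simp: lin_ext_simps algebra_simps)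

lemma lin_ext_uminus: "lin_ext (\<lambda>m. - f m) xs = - lin_ext f xs"
  by (induction xs) (auto simp: lin_ext_simps algebra_simps)

text \<open>Each merge of two letters shortens the list by one, so the factor
  \<open>(-1) ^ length m\<close> absorbs the minus sign of the merging term.\<close>

lemma lin_ext_hprod_rev:
  fixes f :: "nat list \<Rightarrow> 'a::comm_ring_1"
  shows "lin_ext (\<lambda>m. (-1) ^ length m * f m) (hprod_rev k l) =
    (-1) ^ (length k + length l) * qsh f k l"
proof (induction k l arbitrary: f rule: hprod_rev.induct)
  case (3 a k b l)
  show ?case
    by (simp add: lin_ext_simps lin_ext_map lin_ext_uminus 3) (simp add: algebra_simps)
qed (auto simp: lin_ext_simps)

lemma lin_ext_hprod_word:
  fixes f :: "nat list \<Rightarrow> 'a::comm_ring_1"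
  shows "lin_ext f (hprod_word k l) =
    (-1) ^ (length k + length l) * qsh (\<lambda>m. (-1) ^ length m * f m) k l"
proof -
  have "lin_ext f (hprod_word k l) =
      lin_ext (\<lambda>m. (-1) ^ length m * ((-1) ^ length (rev m) * f (rev m))) (hprod_rev (rev k) (rev l))"
    by (simp add: hprod_word_def lin_ext_map flip: mult.assoc power_add)
  then show ?thesis
    using qsh_rev[of "\<lambda>m. (-1) ^ length m * f m" k l] unfolding lin_ext_hprod_rev by simp
qed

text \<open>The signs from transporting indices to words cancel those of the word product, leaving
  only positive structure constants.\<close>

lemma lin_ext_hprod_idx:
  fixes f :: "nat list \<Rightarrow> 'a::comm_ring_1"
  shows "lin_ext f (hprod_idx k l) = qsh f k l"
proof -
  have "lin_ext f (map (\<lambda>(c, m). ((-1) ^ (n + length m) * c, m)) xs) =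
      (-1) ^ n * lin_ext (\<lambda>m. (-1) ^ length m * f m) xs" for n xs
    by (induction xs) (auto simp: lin_ext_simps algebra_simps power_add)
  then show ?thesis
    unfolding hprod_idx_def by (simp add: lin_ext_hprod_word flip: mult.assoc power_add)
qed

text \<open>The restriction to indices matters: on lists with a zero entry \<open>zeta_star\<close>
  has the default value 0, and multiplicativity fails for \<open>[0]\<close> and \<open>[1]\<close>,
  whose letters merge to \<open>[1]\<close>.\<close>

definition stuffle_hom :: "(nat list \<Rightarrow> 'a::comm_ring_1) \<Rightarrow> bool" where
  "stuffle_hom f \<longleftrightarrow> (\<forall>k l. is_index k \<longrightarrow> is_index l \<longrightarrow> qsh f k l = f k * f l)"

lemma is_index_simps [simp]:
  "is_index []" "is_index (a # k) \<longleftrightarrow> 0 < a \<and> is_index k" "is_index (rev k) \<longleftrightarrow> is_index k"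
  by (auto simp: is_index_def)

lemma is_index_take_drop: "is_index k \<Longrightarrow> is_index (take i k)" "is_index k \<Longrightarrow> is_index (drop i k)"
  by (auto simp: is_index_def dest: in_set_takeD in_set_dropD)

section \<open>Operations preserving multiplicativity\<close>

lemma stuffle_hom_rev: "stuffle_hom f \<Longrightarrow> stuffle_hom (\<lambda>k. f (rev k))"
  unfolding stuffle_hom_def
  by (metis is_index_simps(3) qsh_rev rev_rev_ident)

lemma stuffle_hom_comp:
  assumes "stuffle_hom f" "\<And>x y. \<phi> (x + y) = \<phi> x + \<phi> y" "\<And>x y. \<phi> (x * y) = \<phi> x * \<phi> y"
  shows "stuffle_hom (\<lambda>k. \<phi> (f k))"
  using assms by (simp add: stuffle_hom_def qsh_hom)

lemma stuffle_hom_weight: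
  assumes "stuffle_hom f"
  shows "stuffle_hom (\<lambda>k. (-1) ^ wt k * f k)"
proof -
  have "(-1) ^ wt k = prod_list (map (\<lambda>a. (-1) ^ a :: 'a) k)" for k
    by (induction k) (auto simp: wt_def power_add)
  then show ?thesis
    using assms qsh_weight[of "\<lambda>a. (-1) ^ a :: 'a" f]
    by (simp add: stuffle_hom_def power_add algebra_simps)
qed

definition convol :: "(nat list \<Rightarrow> 'a::comm_ring_1) \<Rightarrow> (nat list \<Rightarrow> 'a) \<Rightarrow> nat list \<Rightarrow> 'a" where
  "convol f g k = (\<Sum>i\<le>length k. f (take i k) * g (drop i k))"

lemma convol_simps:
  "convol f g [] = f [] * g []"
  "convol f g (a # k) = f [] * g (a # k) + convol (\<lambda>m. f (a # m)) g k"
  by (auto simp: convol_def sum.atMost_Suc_shift simp del: sum.atMost_Suc)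

text \<open>Deconcatenation is a homomorphism for the harmonic product, the bialgebra axiom of the
  quasi-shuffle algebra. A peeled first letter is absorbed by \<open>f\<close> alone, hence the
  induction varies \<open>f\<close> and fixes \<open>g\<close>.\<close>

lemma qsh_convol:
  "qsh (convol f g) k l = (\<Sum>i\<le>length k. \<Sum>j\<le>length l.
     qsh f (take i k) (take j l) * qsh g (drop i k) (drop j l))"
proof (induction k l arbitrary: f rule: hprod_rev.induct)
  case (1 l)
  then show ?case by (simp add: convol_def)
next
  case (2 a k)
  then show ?case by (simp add: convol_def)
next
  case (3 a k b l)
  show ?case
    by (simp add: convol_simps qsh_add qsh_cmult 3 sum.atMost_Suc_shift sum.distrib
      sum_distrib_left algebra_simps del: sum.atMost_Suc)
qed

lemma stuffle_hom_convol:
  assumes "stuffle_hom f" "stuffle_hom g"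
  shows "stuffle_hom (convol f g)"
  unfolding stuffle_hom_def
proof (intro allI impI)
  fix k l assume kl: "is_index k" "is_index l"
  have "qsh (convol f g) k l = (\<Sum>i\<le>length k. \<Sum>j\<le>length l.
     (f (take i k) * g (drop i k)) * (f (take j l) * g (drop j l)))"
    unfolding qsh_convol using assms kl
    by (intro sum.cong) (auto simp: stuffle_hom_def is_index_take_drop)
  then show "qsh (convol f g) k l = convol f g k * convol f g l"
    by (simp add: convol_def sum_product)
qed

subsection \<open>The shift\<close>

unbundle no vec_syntax
unbundle fps_syntax

text \<open>Up to sign these are binomial coefficients with upper arguments \<open>-a\<close> and
  \<open>-b\<close>, so this compares coefficients in
  \<open>(1-x)^(-a) (1-x)^(-b) = (1-x)^(-(a+b))\<close>.\<close>

lemma binomial_shift_Vandermonde: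
  "(\<Sum>i\<le>n. ((a + i - 1) choose i) * ((b + (n - i) - 1) choose (n - i))) = (a + b + n - 1) choose n"
proof -
  have neg: "real ((a + i - 1) choose i) = (-1) ^ i * ((- real a) gchoose i)" for a i
  proof (cases "a + i = 0")
    \<comment> \<open>The excluded case \<open>a = i = 0\<close> is the one in which the natural
      subtraction truncates.\<close>
    case False
    then have "real (a + i - 1) = real a + real i - 1"
      by (cases a; cases i) auto
    then show ?thesis
      by (simp add: gbinomial_minus binomial_gbinomial flip: mult.assoc power_add)
  qed auto
  have signs: "((-1) ^ i * x) * ((-1) ^ (n - i) * y) = (-1) ^ n * (x * y)" if "i \<le> n" for i and x y :: real
  proof -
    have "(-1) ^ n = (-1 :: real) ^ i * (-1) ^ (n - i)"
      using that by (simp flip: power_add)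
    then show ?thesis by simp
  qed
  have "real (\<Sum>i\<le>n. ((a + i - 1) choose i) * ((b + (n - i) - 1) choose (n - i)))
    = (-1) ^ n * (\<Sum>i\<in>{0..n}. ((- real a) gchoose i) * ((- real b) gchoose (n - i)))"
    unfolding of_nat_sum of_nat_mult neg sum_distrib_left atLeast0AtMost
    by (intro sum.cong refl signs) simp
  also have "\<dots> = real ((a + b + n - 1) choose n)"
    unfolding gbinomial_Vandermonde neg by simp
  finally show ?thesis
    by (simp only: of_nat_eq_iff)
qed

lemma sum_triangle_swap:
  fixes h :: "nat \<Rightarrow> nat \<Rightarrow> 'a::comm_monoid_add"
  shows "(\<Sum>i\<le>n. \<Sum>j\<le>n - i. h i j) = (\<Sum>j\<le>n. \<Sum>i\<le>n - j. h i j)"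
  by (subst sum.Sigma, simp, simp, subst sum.Sigma, simp, simp,
      rule sum.reindex_bij_witness[of _ prod.swap prod.swap]) auto

text \<open>Reading \<open>\<phi> n\<close> as the value at \<open>y^n\<close>, this is the value at
  the \<open>a\<close>-th power of \<open>y / (1 - c X y)\<close>. Values of \<open>\<phi>\<close>
  are power series so that shifts of several letters can be nested.\<close>

definition letter_shift :: "'a::comm_ring_1 \<Rightarrow> nat \<Rightarrow> (nat \<Rightarrow> 'a fps) \<Rightarrow> 'a fps" where
  "letter_shift c a \<phi> = Abs_fps (\<lambda>m.
     \<Sum>j\<le>m. of_nat ((a + j - 1) choose j) * c ^ j * fps_nth (\<phi> (a + j)) (m - j))"

lemma letter_shift_cong:
  "(\<And>j. \<phi> (a + j) = \<psi> (a + j)) \<Longrightarrow> letter_shift c a \<phi> = letter_shift c a \<psi>"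
  by (simp add: letter_shift_def)

lemma letter_shift_add:
  "letter_shift c a (\<lambda>x. \<phi> x + \<psi> x) = letter_shift c a \<phi> + letter_shift c a \<psi>"
  by (rule fps_ext) (simp add: letter_shift_def algebra_simps sum.distrib)

lemma letter_shift_cmult:
  "letter_shift c a (\<lambda>x. C * \<phi> x) = C * letter_shift c a \<phi>"
proof (rule fps_ext)
  fix n
  have "letter_shift c a (\<lambda>x. C * \<phi> x) $ n = (\<Sum>j\<le>n. \<Sum>i\<le>n - j.
      of_nat ((a + j - 1) choose j) * c ^ j * (C $ i * \<phi> (a + j) $ (n - i - j)))"
    by (simp add: letter_shift_def fps_mult_nth sum_distrib_left atLeast0AtMost add.commute)
  also have "\<dots> = (C * letter_shift c a \<phi>) $ n"
    by (subst sum_triangle_swap)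
      (simp add: letter_shift_def fps_mult_nth sum_distrib_left atLeast0AtMost mult_ac)
  finally show "letter_shift c a (\<lambda>x. C * \<phi> x) $ n = (C * letter_shift c a \<phi>) $ n" .
qed

lemma letter_shift_commute:
  "letter_shift c a (\<lambda>x. letter_shift c b (\<phi> x)) =
   letter_shift c b (\<lambda>y. letter_shift c a (\<lambda>x. \<phi> x y))"
proof (rule fps_ext)
  fix n
  show "letter_shift c a (\<lambda>x. letter_shift c b (\<phi> x)) $ n =
      letter_shift c b (\<lambda>y. letter_shift c a (\<lambda>x. \<phi> x y)) $ n"
    unfolding letter_shift_def fps_nth_Abs_fps sum_distrib_left
    by (subst sum_triangle_swap) (simp add: mult_ac add.commute)
qed

text \<open>The substitution respects \<open>y^a y^b = y^(a+b)\<close>: collecting the terms of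
  total shift \<open>p\<close> leaves Vandermonde's identity. This handles the merged
  letters.\<close>

lemma letter_shift_plus:
  "letter_shift c a (\<lambda>x. letter_shift c b (\<lambda>y. \<phi> (x + y))) = letter_shift c (a + b) \<phi>"
proof (rule fps_ext)
  fix n
  let ?B = "\<lambda>a j. of_nat ((a + j - 1) choose j) :: 'a"
  have "letter_shift c a (\<lambda>x. letter_shift c b (\<lambda>y. \<phi> (x + y))) $ n =
     (\<Sum>i\<le>n. \<Sum>j\<le>n - i. ?B a i * ?B b j * c ^ (i + j) * \<phi> (a + b + (i + j)) $ (n - (i + j)))"
    by (simp add: letter_shift_def sum_distrib_left mult_ac power_add add_ac)
  also have "\<dots> = (\<Sum>p\<le>n. \<Sum>i\<le>p.
      ?B a i * ?B b (p - i) * c ^ p * \<phi> (a + b + p) $ (n - p))"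
    by (subst sum.Sigma, simp, simp, subst sum.Sigma, simp, simp,
        rule sum.reindex_bij_witness[of _ "\<lambda>(p, i). (i, p - i)" "\<lambda>(i, j). (i + j, i)"]) auto
  also have "\<dots> = (\<Sum>p\<le>n. ?B (a + b) p * c ^ p * \<phi> (a + b + p) $ (n - p))"
    unfolding binomial_shift_Vandermonde[symmetric] by (simp add: sum_distrib_right)
  finally show "letter_shift c a (\<lambda>x. letter_shift c b (\<lambda>y. \<phi> (x + y))) $ n = letter_shift c (a + b) \<phi> $ n"
    by (simp add: letter_shift_def)
qed

text \<open>Nesting the shifts letter by letter matches the recursion of \<open>qsh\<close>;
  \<open>idx_shift_conv_sum\<close> recovers the sum over tuples.\<close>

fun idx_shift :: "'a::comm_ring_1 \<Rightarrow> (nat list \<Rightarrow> 'a fps) \<Rightarrow> nat list \<Rightarrow> 'a fps" where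
  "idx_shift c F [] = F []"
| "idx_shift c F (a # k) = letter_shift c a (\<lambda>x. idx_shift c (\<lambda>m. F (x # m)) k)"

text \<open>Shifting only raises letters, so \<open>F\<close> is evaluated at indices only.\<close>

lemma idx_shift_cong:
  assumes "\<And>m. is_index m \<Longrightarrow> F m = G m" "is_index k"
  shows "idx_shift c F k = idx_shift c G k"
  using assms
proof (induction k arbitrary: F G)
  case (Cons a k)
  show ?case
    unfolding idx_shift.simps
    using Cons.prems by (intro letter_shift_cong Cons.IH) simp_all
qed simp

lemma idx_shift_add: "idx_shift c (\<lambda>m. F m + G m) k = idx_shift c F k + idx_shift c G k"
  by (induction k arbitrary: F G) (auto simp: letter_shift_add)

lemma idx_shift_cmult: "idx_shift c (\<lambda>m. C * F m) k = C * idx_shift c F k"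
  by (induction k arbitrary: F) (auto simp: letter_shift_cmult)

lemma idx_shift_letter_shift:
  "idx_shift c (\<lambda>m. letter_shift c b (F m)) k = letter_shift c b (\<lambda>y. idx_shift c (\<lambda>m. F m y) k)"
proof (induction k arbitrary: F)
  case (Cons a k)
  show ?case by (simp add: Cons letter_shift_commute[of c a])
qed auto

lemma qsh_letter_shift:
  "qsh (\<lambda>m. letter_shift c b (F m)) k l = letter_shift c b (\<lambda>y. qsh (\<lambda>m. F m y) k l)"
  by (induction k l arbitrary: F rule: hprod_rev.induct) (auto simp: letter_shift_add)

text \<open>The shift is an endomorphism for the harmonic product. Letter shifts commute with
  \<open>qsh\<close> and with each other; the merging term is
  \<open>letter_shift_plus\<close>.\<close>

lemma qsh_idx_shift:
  "qsh (idx_shift c F) k l = idx_shift c (\<lambda>m. idx_shift c (\<lambda>n. qsh F m n) l) k"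
proof (induction k l arbitrary: F rule: hprod_rev.induct)
  case (3 a k b l)
  show ?case
    by (simp add: 3 qsh_letter_shift idx_shift_letter_shift idx_shift_add letter_shift_add
       letter_shift_plus[symmetric, of c a b] letter_shift_commute[of c b a])
next
  case (1 l)
  have "qsh F [] = F" by auto
  then show ?case by simp
qed auto

lemma stuffle_hom_idx_shift:
  assumes "stuffle_hom F"
  shows "stuffle_hom (idx_shift c F)"
  unfolding stuffle_hom_def
proof (intro allI impI)
  fix k l assume k: "is_index k" and l: "is_index l"
  have "qsh (idx_shift c F) k l = idx_shift c (\<lambda>m. idx_shift c (\<lambda>n. F m * F n) l) k"
    unfolding qsh_idx_shift using assms k l
    by (intro idx_shift_cong) (auto simp: stuffle_hom_def)
  then show "qsh (idx_shift c F) k l = idx_shift c F k * idx_shift c F l"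
    by (simp add: idx_shift_cmult mult.commute[of _ "idx_shift c F l"])
qed

text \<open>For constant series all powers of \<open>X\<close> come from the shifts, so coefficient
  \<open>w\<close> collects exactly the tuples of weight \<open>w\<close>.\<close>

lemma idx_shift_conv_sum:
  "idx_shift c (\<lambda>m. fps_const (f m)) k $ w =
   (\<Sum>n\<in>{n. length n = length k \<and> wt n = w}. of_nat (bcoef k n) * c ^ w * f (oplus k n))"
proof (induction k arbitrary: f w)
  case Nil
  have "{n :: nat list. length n = 0 \<and> wt n = w} = (if w = 0 then {[]} else {})"
    by (auto simp: wt_def)
  then show ?case by (simp add: bcoef_def oplus_def)
next
  case (Cons a k)
  let ?S = "\<lambda>k w. {n :: nat list. length n = length k \<and> wt n = w}"
  have fin: "finite (?S k w)" for k :: "nat list" and w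
    by (rule finite_subset[OF _ finite_lists_length_eq[of "{..w}" "length k"]])
      (auto simp: wt_def member_le_sum_list)
  have pow: "c ^ j * (c ^ (w - j) * z) = c ^ w * z" if "j \<le> w" for j z
    using that by (simp flip: mult.assoc power_add)
  have "idx_shift c (\<lambda>m. fps_const (f m)) (a # k) $ w =
      (\<Sum>j\<le>w. \<Sum>n\<in>?S k (w - j). of_nat (bcoef (a # k) (j # n)) * c ^ w * f (oplus (a # k) (j # n)))"
    unfolding idx_shift.simps letter_shift_def fps_nth_Abs_fps Cons sum_distrib_left
    by (intro sum.cong refl)
      (simp add: bcoef_def oplus_def prod.lessThan_Suc_shift algebra_simps pow
        del: prod.lessThan_Suc)
  also have "\<dots> = (\<Sum>n\<in>?S (a # k) w. of_nat (bcoef (a # k) n) * c ^ w * f (oplus (a # k) n))"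
    by (subst sum.Sigma, simp, simp add: fin,
        rule sum.reindex_bij_witness[of _ "\<lambda>n. (hd n, tl n)" "\<lambda>(j, n). j # n"])
      (auto simp: wt_def length_Suc_conv)
  finally show ?case .
qed

lemma shift_fps_conv_idx_shift:
  "shift_fps c = idx_shift [:-c:] (\<lambda>m. fps_const (zeta_star m))"
proof (intro ext fps_ext)
  fix k n
  show "shift_fps c k $ n = idx_shift [:-c:] (\<lambda>m. fps_const (zeta_star m)) k $ n"
    unfolding idx_shift_conv_sum
    by (simp add: shift_fps_def of_nat_poly mult.commute poly_const_pow)
qed

lemma stuffle_hom_shift_fps:
  assumes "stuffle_hom zeta_star"
  shows "stuffle_hom (shift_fps c)"
  unfolding shift_fps_conv_idx_shift
  by (intro stuffle_hom_idx_shift stuffle_hom_comp[OF assms])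
    (simp_all flip: fps_const_add fps_const_mult)

subsection \<open>Truncated sums\<close>

text \<open>The head of the list is the exponent of the largest summation variable, so that \<open>mzv k\<close> is the
  limit of the truncated sums of \<open>rev k\<close>.\<close>
fun trunc_sum :: "nat \<Rightarrow> nat list \<Rightarrow> real" where
  "trunc_sum N [] = 1"
| "trunc_sum 0 (a # k) = 0"
| "trunc_sum (Suc N) (a # k) = trunc_sum N (a # k) + trunc_sum N k / real (Suc N) ^ a"

lemma trunc_sum_one: "trunc_sum N [Suc 0] = harm N"
  by (induction N) (auto simp: harm_Suc harm_def inverse_eq_divide)

lemma trunc_sum_Cons: "trunc_sum N (a # k) = (\<Sum>n<N. trunc_sum n k / real (Suc n) ^ a)"
  by (induction N) auto

lemma trunc_sum_nonneg: "trunc_sum N k \<ge> 0"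
  by (induction N k rule: trunc_sum.induct) auto

text \<open>Passing from \<open>N\<close> to \<open>N + 1\<close> adds \<open>?x ^ a\<close> times
  the value at the tail. Multiplying two such sums out gives the three kinds of terms of the
  recursion of \<open>qsh\<close>.\<close>

lemma trunc_sum_stuffle: "qsh (trunc_sum N) k l = trunc_sum N k * trunc_sum N l"
proof (induction N arbitrary: k l)
  case 0
  have "qsh (trunc_sum 0) (a # k) (b # l) = 0" for a k b l
    by simp
  then show ?case
    by (cases k; cases l) (auto simp del: qsh.simps(3))
next
  case (Suc N)
  show ?case
  proof (cases "k = [] \<or> l = []")
    case False
    then obtain a k' b l' where kl: "k = a # k'" "l = b # l'"
      by (auto simp: neq_Nil_conv)
    let ?x = "1 / real (Suc N)"
    have step: "(\<lambda>m. trunc_sum (Suc N) (c # m)) =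
        (\<lambda>m. trunc_sum N (c # m) + ?x ^ c * trunc_sum N m)" for c
      by (auto simp: power_divide)
    have "qsh (trunc_sum (Suc N)) k l = qsh (trunc_sum N) k l + ?x ^ b * qsh (trunc_sum N) k l'
        + ?x ^ a * qsh (trunc_sum N) k' l + ?x ^ (a + b) * qsh (trunc_sum N) k' l'"
      unfolding kl qsh.simps step qsh_add qsh_cmult by simp
    also have "\<dots> = (trunc_sum N k + ?x ^ a * trunc_sum N k') * (trunc_sum N l + ?x ^ b * trunc_sum N l')"
      unfolding Suc by (simp add: algebra_simps power_add)
    also have "\<dots> = trunc_sum (Suc N) k * trunc_sum (Suc N) l"
      by (simp add: kl power_divide)
    finally show ?thesis .
  qed auto
qed

lemma trunc_sum_le: "is_index k \<Longrightarrow> trunc_sum N k \<le> harm N ^ length k"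
proof (induction N k rule: trunc_sum.induct)
  case (3 N a k)
  let ?x = "1 / real (Suc N)" and ?h = "harm N :: real"
  have h: "?h \<ge> 0" by (rule harm_nonneg)
  have "?x ^ a \<le> ?x"
    using 3 power_decreasing[of 1 a ?x] by auto
  then have "trunc_sum N k / real (Suc N) ^ a \<le> ?h ^ length k * ?x"
    using 3 mult_mono[of "trunc_sum N k" "?h ^ length k" "?x ^ a" ?x] h
    by (auto simp: power_divide)
  then have "trunc_sum (Suc N) (a # k) \<le> ?h ^ Suc (length k) + ?h ^ length k * ?x"
    using 3 by auto
  also have "\<dots> = (?h + ?x) * ?h ^ length k"
    by (simp add: algebra_simps)
  also have "\<dots> \<le> (?h + ?x) * (?h + ?x) ^ length k"
    using h by (intro mult_left_mono power_mono) auto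
  finally show ?case
    by (simp add: harm_Suc inverse_eq_divide)
qed (auto simp: harm_def)

lemma summable_harm_power: "summable (\<lambda>n. harm n ^ p / real (Suc n) ^ 2)"
proof -
  \<comment> \<open>The exponent satisfies \<open>?e * p \<le> 1/2\<close>, so the power of
    \<open>harm n\<close> costs at most \<open>1/2\<close> of the exponent 2; the base of
    \<open>?C\<close> is \<open>1 + 1 / ?e\<close>.\<close>
  let ?e = "1 / (2 * real p + 2)" and ?C = "(2 * real p + 3) ^ p"
  have bound: "harm n ^ p / real (Suc n) ^ 2 \<le> ?C * real (Suc n) powr (- 3 / 2)" for n
  proof -
    let ?x = "real (Suc n)"
    have "harm (Suc n) - ln ?x \<le> harm 1 - ln (1::real)"
      using decseqD[OF decseq_harm_diff_ln, of 0 n] by simp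
    moreover have "harm n \<le> (harm (Suc n) :: real)"
      by (intro harm_mono) auto
    moreover have "harm 1 = (1 :: real)"
      by (simp add: harm_def)
    ultimately have "harm n \<le> 1 + ln ?x"
      by simp
    also have "\<dots> \<le> ?x powr ?e + ?x powr ?e / ?e"
      by (intro add_mono ln_powr_bound ge_one_powr_ge_zero) auto
    also have "\<dots> = (2 * real p + 3) * ?x powr ?e"
      by (simp add: field_simps)
    finally have "harm n ^ p \<le> ((2 * real p + 3) * ?x powr ?e) ^ p"
      by (intro power_mono harm_nonneg)
    also have "\<dots> = ?C * ?x powr (?e * real p)"
      by (simp add: power_mult_distrib powr_power)
    also have "\<dots> \<le> ?C * ?x powr (1 / 2)"
      by (intro mult_left_mono powr_mono) (auto simp: field_simps)
    finally have "harm n ^ p / ?x ^ 2 \<le> ?C * ?x powr (1 / 2) / ?x powr 2"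
      by (simp add: divide_right_mono)
    also have "\<dots> = ?C * ?x powr (- 3 / 2)"
      by (simp only: times_divide_eq_right[symmetric] powr_diff[symmetric]) simp
    finally show ?thesis .
  qed
  have "summable (\<lambda>n. real (Suc n) powr (- 3 / 2))"
    by (subst summable_Suc_iff) (simp add: summable_real_powr_iff)
  then have "summable (\<lambda>n. ?C * real (Suc n) powr (- 3 / 2))"
    by (rule summable_mult)
  then show ?thesis
    by (rule summable_comparison_test') (use bound harm_nonneg in \<open>auto simp: abs_mult power_abs\<close>)
qed

subsection \<open>Asymptotic expansions in harmonic numbers\<close>

text \<open>The factor \<open>harm N ^ j\<close> makes the class of error terms closed under multiplication by
  polynomials in \<open>harm N\<close>.\<close>
definition asymp_poly :: "(nat \<Rightarrow> real) \<Rightarrow> real poly \<Rightarrow> bool" where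
  "asymp_poly f P \<longleftrightarrow> (\<forall>j. (\<lambda>N. harm N ^ j * (f N - poly P (harm N))) \<longlonglongrightarrow> 0)"

lemma asymp_poly_poly: "asymp_poly (\<lambda>N. poly P (harm N)) P"
  by (simp add: asymp_poly_def)

lemma asymp_poly_add:
  assumes "asymp_poly f P" "asymp_poly g Q"
  shows "asymp_poly (\<lambda>N. f N + g N) (P + Q)"
  unfolding asymp_poly_def
proof
  fix j
  have "(\<lambda>N. harm N ^ j * (f N - poly P (harm N)) + harm N ^ j * (g N - poly Q (harm N))) \<longlonglongrightarrow> 0 + 0"
    using assms unfolding asymp_poly_def by (intro tendsto_add) auto
  then show "(\<lambda>N. harm N ^ j * (f N + g N - poly (P + Q) (harm N))) \<longlonglongrightarrow> 0"
    by (simp add: algebra_simps)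
qed

lemma asymp_poly_cmult:
  assumes "asymp_poly f P"
  shows "asymp_poly (\<lambda>N. c * f N) (smult c P)"
  unfolding asymp_poly_def
proof
  fix j
  have "(\<lambda>N. c * (harm N ^ j * (f N - poly P (harm N)))) \<longlonglongrightarrow> c * 0"
    using assms unfolding asymp_poly_def by (intro tendsto_mult_left) auto
  then show "(\<lambda>N. harm N ^ j * (c * f N - poly (smult c P) (harm N))) \<longlonglongrightarrow> 0"
    by (simp add: algebra_simps)
qed

lemma asymp_poly_poly_mult_error:
  assumes "asymp_poly f P"
  shows "(\<lambda>N. poly R (harm N) * (f N - poly P (harm N))) \<longlonglongrightarrow> 0"
proof -
  have "(\<lambda>N. \<Sum>i\<le>degree R. coeff R i * (harm N ^ i * (f N - poly P (harm N)))) \<longlonglongrightarrow>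
      (\<Sum>i\<le>degree R. coeff R i * 0)"
    using assms unfolding asymp_poly_def by (intro tendsto_sum tendsto_mult_left) auto
  then show ?thesis
    by (simp add: poly_altdef sum_distrib_right mult.assoc)
qed

lemma asymp_poly_mult:
  assumes f: "asymp_poly f P" and g: "asymp_poly g Q"
  shows "asymp_poly (\<lambda>N. f N * g N) (P * Q)"
  unfolding asymp_poly_def
proof
  fix j
  let ?f = "\<lambda>N. f N - poly P (harm N)" and ?g = "\<lambda>N. g N - poly Q (harm N)"
  \<comment> \<open>The error of the product is the product of the errors plus each error times the
    other polynomial. The monomial absorbs \<open>harm N ^ j\<close>, and \<open>harm N ^ 0\<close>
    is the case of exponent 0 in \<open>asymp_poly\<close>.\<close>
  have *: "(\<lambda>N. (harm N ^ j * ?f N) * (harm N ^ 0 * ?g N) + poly (monom 1 j * Q) (harm N) * ?f N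
      + poly (monom 1 j * P) (harm N) * ?g N) \<longlonglongrightarrow> 0 * 0 + 0 + 0"
    by (intro tendsto_add tendsto_mult asymp_poly_poly_mult_error assms)
      (use assms in \<open>unfold asymp_poly_def, blast+\<close>)
  have "harm N ^ j * (f N * g N - poly (P * Q) (harm N)) =
     (harm N ^ j * ?f N) * (harm N ^ 0 * ?g N) + poly (monom 1 j * Q) (harm N) * ?f N
      + poly (monom 1 j * P) (harm N) * ?g N" for N
    by (simp add: poly_monom algebra_simps)
  with * show "(\<lambda>N. harm N ^ j * (f N * g N - poly (P * Q) (harm N))) \<longlonglongrightarrow> 0"
    by simp
qed

text \<open>Harmonic numbers are unbounded, and a polynomial with positive leading coefficient
  eventually exceeds that coefficient; apply this to \<open>R\<close> and
  \<open>- R\<close>.\<close>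

lemma poly_harm_tendsto_0D:
  assumes "(\<lambda>N. poly R (harm N)) \<longlonglongrightarrow> (0::real)"
  shows "R = 0"
proof -
  have *: "lead_coeff R \<le> 0" if "(\<lambda>N. poly R (harm N)) \<longlonglongrightarrow> (0::real)" for R
  proof (rule ccontr)
    assume "\<not> lead_coeff R \<le> 0"
    then obtain n where n: "\<And>x. x \<ge> n \<Longrightarrow> poly R x \<ge> lead_coeff R" "lead_coeff R > 0"
      using poly_pinfty_gt_lc[of R] by auto
    have "eventually (\<lambda>N. harm N \<ge> n) sequentially"
      using harm_at_top by (simp add: filterlim_at_top)
    then have "eventually (\<lambda>N. lead_coeff R \<le> poly R (harm N)) sequentially"
      by eventually_elim (use n in auto)
    then have "lead_coeff R \<le> 0"
      using that tendsto_lowerbound by force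
    with n show False by simp
  qed
  have "(\<lambda>N. poly (- R) (harm N)) \<longlonglongrightarrow> - 0"
    unfolding poly_minus by (intro tendsto_minus assms)
  with *[of R] *[of "- R"] assms show ?thesis
    by (auto simp: lead_coeff_minus)
qed

lemma asymp_poly_unique:
  assumes "asymp_poly f P" "asymp_poly f Q"
  shows "P = Q"
proof -
  have "(\<lambda>N. harm N ^ 0 * (f N - poly Q (harm N)) - harm N ^ 0 * (f N - poly P (harm N))) \<longlonglongrightarrow> 0 - 0"
    using assms unfolding asymp_poly_def by (intro tendsto_diff) blast+
  then show ?thesis
    using poly_harm_tendsto_0D[of "P - Q"] by simp
qed

text \<open>The sum converges, and since \<open>harm\<close> is monotone, \<open>harm N ^ j\<close>
  can be moved inside the tail. The result is bounded by a tail of the series in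
  \<open>summable_harm_power\<close>.\<close>

lemma asymp_poly_const_trunc_sum:
  assumes "is_index k" "a \<ge> 2"
  shows "\<exists>L. asymp_poly (\<lambda>N. trunc_sum N (a # k)) [:L:]"
proof -
  let ?u = "\<lambda>n. trunc_sum n k / real (Suc n) ^ a"
  let ?v = "\<lambda>p n. harm n ^ p / real (Suc n) ^ 2 :: real"
  have uv: "?u n \<le> ?v (length k) n" for n
    using assms trunc_sum_le[of k n] trunc_sum_nonneg[of n k]
    by (intro frac_le power_increasing) auto
  have u0: "?u n \<ge> 0" for n
    using trunc_sum_nonneg[of n k] by auto
  have v: "summable (?v p)" for p
    by (rule summable_harm_power)
  have u: "summable ?u"
    by (rule summable_comparison_test'[OF v[of "length k"]]) (use uv trunc_sum_nonneg in simp)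
  have "asymp_poly (\<lambda>N. trunc_sum N (a # k)) [:suminf ?u:]"
    unfolding asymp_poly_def
  proof
    fix j
    have "(\<lambda>N. suminf (?v (j + length k)) - (\<Sum>n<N. ?v (j + length k) n)) \<longlonglongrightarrow>
        suminf (?v (j + length k)) - suminf (?v (j + length k))"
      by (intro tendsto_diff tendsto_const summable_LIMSEQ v)
    then have lim: "(\<lambda>N. suminf (?v (j + length k)) - (\<Sum>n<N. ?v (j + length k) n)) \<longlonglongrightarrow> 0"
      by simp
    have "norm (harm N ^ j * (trunc_sum N (a # k) - poly [:suminf ?u:] (harm N))) \<le>
        suminf (?v (j + length k)) - (\<Sum>n<N. ?v (j + length k) n)" for N
    proof -
      have h: "harm N \<ge> (0::real)" by (rule harm_nonneg)
      have shift: "summable (\<lambda>n. ?u (n + N))" "summable (\<lambda>n. ?v p (n + N))" for p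
        using u v by (subst summable_iff_shift; simp)+
      have tail: "suminf ?u - trunc_sum N (a # k) = (\<Sum>n. ?u (n + N))"
        unfolding trunc_sum_Cons by (subst suminf_split_initial_segment[OF u, of N]) simp
      have "(\<Sum>n. ?u (n + N)) \<ge> 0"
        by (intro suminf_nonneg shift u0)
      then have "norm (harm N ^ j * (trunc_sum N (a # k) - poly [:suminf ?u:] (harm N))) =
          harm N ^ j * (\<Sum>n. ?u (n + N))"
        using h tail by (simp add: abs_mult power_abs flip: tail)
      also have "\<dots> = (\<Sum>n. harm N ^ j * ?u (n + N))"
        by (intro suminf_mult[symmetric] shift)
      also have "\<dots> \<le> (\<Sum>n. ?v (j + length k) (n + N))"
      proof (intro suminf_le summable_mult shift)
        fix n
        have "harm N ^ j * ?u (n + N) \<le> harm (n + N) ^ j * ?v (length k) (n + N)"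
          using h by (intro mult_mono power_mono harm_mono uv u0) (auto simp: harm_nonneg)
        then show "harm N ^ j * ?u (n + N) \<le> ?v (j + length k) (n + N)"
          by (simp add: power_add)
      qed
      also have "\<dots> = suminf (?v (j + length k)) - (\<Sum>n<N. ?v (j + length k) n)"
        by (subst suminf_split_initial_segment[OF v, of _ N]) simp
      finally show ?thesis .
    qed
    then show "(\<lambda>N. harm N ^ j * (trunc_sum N (a # k) - poly [:suminf ?u:] (harm N))) \<longlonglongrightarrow> 0"
      by (intro Lim_null_comparison[OF _ lim] always_eventually) auto
  qed
  then show ?thesis by blast
qed

subsection \<open>Regularization\<close>

fun lead_ones :: "nat list \<Rightarrow> nat" where
  "lead_ones [] = 0"
| "lead_ones (a # k) = (if a = 1 then Suc (lead_ones k) else 0)"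

text \<open>Inserting 1 at any of the \<open>lead_ones w + 1\<close> places around the leading ones
  gives \<open>1 # w\<close>; a later insertion or a merge creates no further leading 1. The list
  \<open>ws\<close> is independent of \<open>f\<close>, so two functions can be compared.\<close>

lemma qsh_one_expansion:
  assumes "is_index w"
  shows "\<exists>ws. (\<forall>v\<in>set ws. is_index v \<and> lead_ones v \<le> lead_ones w) \<and>
    (\<forall>f :: nat list \<Rightarrow> 'a::comm_ring_1.
       qsh f w [1] = of_nat (lead_ones w + 1) * f (1 # w) + sum_list (map f ws))"
  using assms
proof (induction w)
  case Nil
  show ?case by (intro exI[of _ "[]"]) auto
next
  case (Cons a w)
  then obtain ws where ws: "\<And>v. v \<in> set ws \<Longrightarrow> is_index v \<and> lead_ones v \<le> lead_ones w"
    "\<And>f :: nat list \<Rightarrow> 'a.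
       qsh f w [1] = of_nat (lead_ones w + 1) * f (1 # w) + sum_list (map f ws)"
    by auto
  show ?case
  proof (cases "a = 1")
    case True
    then show ?thesis
      using ws Cons.prems
      by (intro exI[of _ "map ((#) 1) ws @ [2 # w]"]) (auto simp: o_def algebra_simps numeral_2_eq_2)
  next
    case False
    then show ?thesis
      using ws Cons.prems
      \<comment> \<open>Behind a first letter other than 1 every inserted 1 is harmless, so these
        copies join the remainder.\<close>
      by (intro exI[of _ "replicate (lead_ones w + 1) (a # 1 # w) @ map ((#) a) ws @ [(a + 1) # w]"])
        (auto simp: o_def algebra_simps sum_list_replicate)
  qed
qed

lemma asymp_poly_trunc_sum_ex: "is_index w \<Longrightarrow> \<exists>P. asymp_poly (\<lambda>N. trunc_sum N w) P"
proof (induction "lead_ones w" arbitrary: w rule: less_induct)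
  case less
  show ?case
  proof (cases "lead_ones w")
    case 0
    then consider "w = []" | a k where "w = a # k" "is_index k" "a \<ge> 2"
      using less.prems by (cases w) (force split: if_splits)+
    then show ?thesis
    proof cases
      case 1
      then show ?thesis using asymp_poly_poly[of 1] by auto
    qed (use asymp_poly_const_trunc_sum in blast)
  next
    case (Suc m)
    then obtain v where w: "w = 1 # v" and m: "lead_ones v = m"
      by (cases w) (auto split: if_splits)
    with less.prems have v: "is_index v" by simp
    obtain ws where ws: "\<And>u. u \<in> set ws \<Longrightarrow> is_index u \<and> lead_ones u \<le> m"
      "\<And>f :: nat list \<Rightarrow> real.
         qsh f v [1] = of_nat (m + 1) * f w + sum_list (map f ws)"
      using qsh_one_expansion[OF v] m w by metis
    have "\<exists>P. asymp_poly (\<lambda>N. trunc_sum N u) P" if "u \<in> set ws" for u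
      using less.hyps[of u] ws(1)[OF that] Suc by auto
    then have "\<exists>P. asymp_poly (\<lambda>N. sum_list (map (trunc_sum N) ws)) P"
    proof (induction ws)
      case Nil
      then show ?case using asymp_poly_poly[of 0] by auto
    next
      case (Cons u ws)
      then obtain P Q where "asymp_poly (\<lambda>N. trunc_sum N u) P"
        "asymp_poly (\<lambda>N. sum_list (map (trunc_sum N) ws)) Q"
        by (metis list.set_intros)
      from asymp_poly_add[OF this] show ?case by auto
    qed
    then obtain P where P: "asymp_poly (\<lambda>N. sum_list (map (trunc_sum N) ws)) P" by blast
    obtain Q where Q: "asymp_poly (\<lambda>N. trunc_sum N v) Q"
      using less.hyps[of v] v m Suc by auto
    have "asymp_poly (\<lambda>N. harm N) [:0, 1:]"
      using asymp_poly_poly[of "[:0, 1:]"] by simp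
    from asymp_poly_cmult[OF asymp_poly_add[OF asymp_poly_mult[OF Q this]
        asymp_poly_cmult[OF P, of "-1"]], of "1 / real (m + 1)"]
    have "asymp_poly (\<lambda>N. 1 / real (m + 1) *
        (trunc_sum N v * harm N + - 1 * sum_list (map (trunc_sum N) ws)))
      (smult (1 / real (m + 1)) (Q * [:0, 1:] + smult (- 1) P))" .
    \<comment> \<open>The expansion of the product of \<open>v\<close> and \<open>[1]\<close>,
      solved for \<open>w\<close>.\<close>
    moreover have "1 / real (m + 1) *
        (trunc_sum N v * harm N + - 1 * sum_list (map (trunc_sum N) ws)) = trunc_sum N w" for N
      using ws(2)[of "trunc_sum N"]
      by (simp add: trunc_sum_stuffle trunc_sum_one)
    ultimately show ?thesis by auto
  qed
qed

text \<open>The product with \<open>[1]\<close> determines the value at \<open>1 # v\<close>,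
  because the positive factor \<open>m + 1\<close> cancels in real polynomials.\<close>

lemma stuffle_hom_eqI:
  fixes f g :: "nat list \<Rightarrow> real poly"
  assumes f: "stuffle_hom f" and g: "stuffle_hom g"
  assumes one: "f [1] = g [1]"
  assumes adm: "\<And>k. is_index k \<Longrightarrow> lead_ones k = 0 \<Longrightarrow> f k = g k"
  shows "is_index w \<Longrightarrow> f w = g w"
proof (induction "lead_ones w" arbitrary: w rule: less_induct)
  case less
  show ?case
  proof (cases "lead_ones w")
    case (Suc m)
    then obtain v where w: "w = 1 # v" and m: "lead_ones v = m"
      by (cases w) (auto split: if_splits)
    with less.prems have v: "is_index v" by simp
    obtain ws where ws: "\<And>u. u \<in> set ws \<Longrightarrow> is_index u \<and> lead_ones u \<le> m"
      "\<And>f :: nat list \<Rightarrow> real poly.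
         qsh f v [1] = of_nat (m + 1) * f w + sum_list (map f ws)"
      using qsh_one_expansion[OF v] m w by metis
    have "f u = g u" if "u \<in> set ws" for u
      using less.hyps[of u] ws(1)[OF that] Suc by auto
    then have "sum_list (map f ws) = sum_list (map g ws)" by (simp cong: map_cong)
    moreover have "f v = g v"
      using less.hyps[of v] v m Suc by auto
    moreover have "qsh f v [1] = f v * f [1]" "qsh g v [1] = g v * g [1]"
      using f g v by (auto simp: stuffle_hom_def)
    ultimately have "of_nat (m + 1) * f w = of_nat (m + 1) * g w"
      using ws(2)[of f] ws(2)[of g] one by (metis add_right_cancel)
    then show ?thesis
      by (simp only: mult_cancel_left of_nat_eq_0_iff) simp
  qed (use adm less.prems in auto)
qed

lemma asymp_poly_qsh:
  assumes "\<And>m. is_index m \<Longrightarrow> asymp_poly (\<lambda>N. F N m) (R m)" "is_index k" "is_index l"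
  shows "asymp_poly (\<lambda>N. qsh (F N) k l) (qsh R k l)"
  using assms
proof (induction k l arbitrary: F R rule: hprod_rev.induct)
  case (3 a k b l)
  show ?case
    unfolding qsh.simps
    using "3.prems" by (intro asymp_poly_add "3.IH") auto
qed auto

text \<open>The terms are nonnegative and the truncated index sets exhaust all finite sets of
  tuples, so the unordered sum is the limit of the truncations.\<close>

lemma mzv_eqI:
  assumes "(\<lambda>N. trunc_sum N (rev k)) \<longlonglongrightarrow> L"
  shows "mzv k = L"
proof -
  let ?F = "\<lambda>k n. \<Prod>i<length k. 1 / real (n ! i) ^ (k ! i)"
  let ?A = "{n :: nat list. length n = length k \<and> sorted_wrt (<) n \<and> (\<forall>x\<in>set n. 0 < x)}"
  let ?T = "\<lambda>k N. {n :: nat list. length n = length k \<and> sorted_wrt (<) n \<and> set n \<subseteq> {0<..N}}"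
  have fin: "finite (?T k N)" for k :: "nat list" and N
    by (rule finite_subset[OF _ finite_lists_length_eq[of "{0<..N}" "length k"]]) auto
  have trunc: "trunc_sum N (rev k) = sum (?F k) (?T k N)" for k N
  proof (induction N arbitrary: k)
    case 0
    show ?case
    proof (cases k rule: rev_cases)
      case Nil
      then have "?T k 0 = {[]}" by auto
      with Nil show ?thesis by simp
    next
      case (snoc k' a)
      then have "?T k 0 = {}" by auto
      with snoc show ?thesis by (simp only:) simp
    qed
  next
    case (Suc N)
    show ?case
    proof (cases k rule: rev_cases)
      case Nil
      then have "?T k (Suc N) = {[]}" by auto
      with Nil show ?thesis by simp
    next
      case (snoc k' a)
      let ?app = "\<lambda>n. n @ [Suc N]"
      \<comment> \<open>An increasing tuple bounded by \<open>N + 1\<close> either ends in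
        \<open>N + 1\<close> or is bounded by \<open>N\<close>.\<close>
      have T: "?T k (Suc N) = ?T k N \<union> ?app ` ?T k' N"
      proof (intro equalityI subsetI)
        fix n assume n: "n \<in> ?T k (Suc N)"
        then obtain n' x where n': "n = n' @ [x]"
          using snoc by (cases n rule: rev_cases) auto
        show "n \<in> ?T k N \<union> ?app ` ?T k' N"
        proof (cases "x = Suc N")
          case True
          have "set n' \<subseteq> {0<..N}"
            using n n' True by (fastforce simp: sorted_wrt_append)
          then show ?thesis
            using n n' True snoc by (auto simp: sorted_wrt_append)
        next
          case False
          then have "set n \<subseteq> {0<..N}"
            using n n' by (fastforce simp: sorted_wrt_append)
          then show ?thesis using n by auto
        qed
      qed (use snoc in \<open>fastforce simp: sorted_wrt_append less_Suc_eq_le\<close>)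
      have inj: "inj_on ?app X" for X by (auto simp: inj_on_def)
      have "sum (?F k) (?T k (Suc N)) = sum (?F k) (?T k N) + sum (?F k) (?app ` ?T k' N)"
        unfolding T by (intro sum.union_disjoint fin finite_imageI) auto
      also have "sum (?F k) (?app ` ?T k' N) = (\<Sum>n\<in>?T k' N. ?F k (?app n))"
        by (subst sum.reindex[OF inj]) simp
      also have "\<dots> = (\<Sum>n\<in>?T k' N. ?F k' n * (1 / real (Suc N) ^ a))"
      proof (intro sum.cong refl)
        fix n assume "n \<in> ?T k' N"
        then have len: "length n = length k'" by auto
        then have "(\<Prod>i<length k'. 1 / real (?app n ! i) ^ (k ! i)) = ?F k' n"
          using snoc by (intro prod.cong) (auto simp: nth_append)
        then show "?F k (?app n) = ?F k' n * (1 / real (Suc N) ^ a)"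
          using snoc len by (simp add: nth_append)
      qed
      also have "\<dots> = trunc_sum N (rev k') / real (Suc N) ^ a"
        by (simp add: Suc sum_divide_distrib)
      finally have "sum (?F k) (?T k (Suc N)) = trunc_sum N (rev k) + trunc_sum N (rev k') / real (Suc N) ^ a"
        unfolding Suc .
      then show ?thesis
        using snoc by simp
    qed
  qed
  have nonneg: "?F k n \<ge> 0" for n
    by (intro prod_nonneg) auto
  have exh: "\<exists>M. \<forall>N\<ge>M. X \<subseteq> ?T k N" if "finite X" "X \<subseteq> ?A" for X
  proof -
    have "finite (\<Union>n\<in>X. set n)"
      using that by simp
    then obtain M where M: "\<And>x. x \<in> (\<Union>n\<in>X. set n) \<Longrightarrow> x \<le> M"
      unfolding finite_nat_set_iff_bounded_le by blast
    show ?thesis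
    proof (intro exI[of _ M] allI impI subsetI)
      fix N n assume N: "M \<le> N" and n: "n \<in> X"
      have "x \<le> M" if "x \<in> set n" for x
        using M n that by blast
      then have "x \<le> N" if "x \<in> set n" for x
        using that N order_trans by blast
      then show "n \<in> ?T k N"
        using that(2) n by auto
    qed
  qed
  obtain C where "\<And>N. norm (trunc_sum N (rev k)) \<le> C"
    using convergent_imp_Bseq[OF convergentI[OF assms]] unfolding Bseq_def by blast
  then have C: "trunc_sum N (rev k) \<le> C" for N
    by (metis abs_le_D1 real_norm_def)
  \<comment> \<open>Needed first, since \<open>infsum\<close> defaults to 0 without
    summability.\<close>
  have "?F k summable_on ?A"
  proof (rule nonneg_bdd_above_summable_on[OF nonneg])
    show "bdd_above (sum (?F k) ` {X. X \<subseteq> ?A \<and> finite X})"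
    proof (rule bdd_aboveI2)
      fix X assume X: "X \<in> {X. X \<subseteq> ?A \<and> finite X}"
      then obtain N where "X \<subseteq> ?T k N"
        using exh[of X] order_refl by (metis (no_types, lifting) mem_Collect_eq)
      then have "sum (?F k) X \<le> sum (?F k) (?T k N)"
        by (intro sum_mono2 fin nonneg)
      then show "sum (?F k) X \<le> C"
        using C[of N] by (simp add: trunc)
    qed
  qed
  then have "(sum (?F k) \<longlongrightarrow> mzv k) (finite_subsets_at_top ?A)"
    unfolding mzv_def using has_sum_infsum has_sum_def by blast
  moreover have "filterlim (?T k) (finite_subsets_at_top ?A) sequentially"
    unfolding filterlim_finite_subsets_at_top eventually_sequentially
  proof (intro allI impI, elim conjE)
    fix X assume "finite X" "X \<subseteq> ?A"
    then obtain M where M: "X \<subseteq> ?T k N" if "N \<ge> M" for N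
      using exh[of X] by metis
    have "?T k N \<subseteq> ?A" for N by auto
    with M fin show "\<exists>M. \<forall>N\<ge>M. finite (?T k N) \<and> X \<subseteq> ?T k N \<and> ?T k N \<subseteq> ?A"
      by (intro exI[of _ M]) blast
  qed
  ultimately have "(\<lambda>N. sum (?F k) (?T k N)) \<longlonglongrightarrow> mzv k"
    by (rule filterlim_compose)
  then have "(\<lambda>N. trunc_sum N (rev k)) \<longlonglongrightarrow> mzv k"
    unfolding trunc .
  then show ?thesis
    using assms by (rule LIMSEQ_unique)
qed

text \<open>On indices the choice is forced by \<open>asymp_poly_unique\<close>; the value 0
  elsewhere agrees with the normalisation in \<open>Zstar_hom\<close>.\<close>

definition reg_poly :: "nat list \<Rightarrow> real poly" where
  "reg_poly w = (if is_index w then SOME P. asymp_poly (\<lambda>N. trunc_sum N w) P else 0)"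

lemma asymp_poly_reg_poly: "is_index w \<Longrightarrow> asymp_poly (\<lambda>N. trunc_sum N w) (reg_poly w)"
  using asymp_poly_trunc_sum_ex[of w] by (auto simp: reg_poly_def intro: someI)

lemma reg_poly_eqI: "is_index w \<Longrightarrow> asymp_poly (\<lambda>N. trunc_sum N w) P \<Longrightarrow> reg_poly w = P"
  using asymp_poly_reg_poly asymp_poly_unique by blast

text \<open>Both sides are expansions of the same product of truncated sums.\<close>

lemma stuffle_hom_reg_poly: "stuffle_hom reg_poly"
  unfolding stuffle_hom_def
proof (intro allI impI)
  fix k l assume kl: "is_index k" "is_index l"
  have "asymp_poly (\<lambda>N. qsh (trunc_sum N) k l) (qsh reg_poly k l)"
    by (intro asymp_poly_qsh asymp_poly_reg_poly kl)
  moreover have "asymp_poly (\<lambda>N. qsh (trunc_sum N) k l) (reg_poly k * reg_poly l)"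
    unfolding trunc_sum_stuffle by (intro asymp_poly_mult asymp_poly_reg_poly kl)
  ultimately show "qsh reg_poly k l = reg_poly k * reg_poly l"
    by (rule asymp_poly_unique)
qed

lemma admissible_iff: "admissible k \<longleftrightarrow> is_index k \<and> lead_ones (rev k) = 0"
  by (cases k rule: rev_cases) (auto simp: admissible_def is_index_def)

lemma reg_poly_admissible:
  assumes "admissible k"
  shows "reg_poly (rev k) = [:mzv k:]"
proof (cases k rule: rev_cases)
  case Nil
  have "mzv k = 1"
    by (rule mzv_eqI) (simp add: Nil)
  then show ?thesis
    using asymp_poly_poly[of 1] by (intro reg_poly_eqI) (auto simp: Nil one_pCons)
next
  case (snoc k' a)
  with assms have "is_index (rev k')" "a \<ge> 2"
    by (auto simp: admissible_def is_index_def)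
  from asymp_poly_const_trunc_sum[OF this] obtain L
    where L: "asymp_poly (\<lambda>N. trunc_sum N (rev k)) [:L:]" by (auto simp: snoc)
  then have "(\<lambda>N. harm N ^ 0 * (trunc_sum N (rev k) - poly [:L:] (harm N))) \<longlonglongrightarrow> 0"
    unfolding asymp_poly_def by blast
  then have "mzv k = L"
    by (intro mzv_eqI) (simp add: LIM_zero_iff)
  with L assms show ?thesis
    by (intro reg_poly_eqI) (auto simp: admissible_def)
qed

lemma reg_poly_one: "reg_poly [1] = [:0, 1:]"
  using asymp_poly_poly[of "[:0, 1:]"] by (intro reg_poly_eqI) (auto simp: trunc_sum_one)

text \<open>Twisting by the sign of the depth passes from words to indices; \<open>- g [1]\<close>
  is the twisted value at \<open>[1]\<close>.\<close>

lemma Zstar_hom_iff: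
  "Zstar_hom g \<longleftrightarrow> stuffle_hom (\<lambda>k. (-1) ^ length k * g k)
     \<and> (\<forall>k. admissible k \<longrightarrow> (-1) ^ length k * g k = [:mzv k:])
     \<and> - g [1] = [:0, 1:] \<and> (\<forall>k. \<not> is_index k \<longrightarrow> g k = 0)"
proof -
  have neg: "- x = y \<longleftrightarrow> x = - y" for x y :: "real poly"
    by (metis minus_minus)
  have sgn: "(-1) ^ n * x = y \<longleftrightarrow> x = (-1) ^ n * y" for n and x y :: "real poly"
    by (cases "even n") (auto simp: neg)
  have "lin_ext g (hprod_word k l) = g k * g l \<longleftrightarrow>
      qsh (\<lambda>k. (-1) ^ length k * g k) k l = (-1) ^ length k * g k * ((-1) ^ length l * g l)" for k l
    unfolding lin_ext_hprod_word by (subst sgn) (simp add: power_add mult_ac)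
  moreover have "(-1) ^ length k * g k = [:mzv k:] \<longleftrightarrow> g k = [:(-1) ^ length k * mzv k:]" for k
    by (cases "even (length k)") (auto simp: neg)
  moreover have "- g [1] = [:0, 1:] \<longleftrightarrow> g [1] = [:0, -1:]"
    by (auto simp: neg)
  ultimately show ?thesis
    unfolding Zstar_hom_def stuffle_hom_def by simp
qed

lemma Zstar_hom_unique:
  assumes f: "Zstar_hom f" and g: "Zstar_hom g"
  shows "f = g"
proof
  fix k
  \<comment> \<open>Reversal turns trailing ones into the leading ones counted by
    \<open>lead_ones\<close>.\<close>
  let ?f = "\<lambda>k. (-1) ^ length (rev k) * f (rev k)" and ?g = "\<lambda>k. (-1) ^ length (rev k) * g (rev k)"
  show "f k = g k"
  proof (cases "is_index k")
    case True
    have "?f (rev k) = ?g (rev k)"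
    proof (rule stuffle_hom_eqI[of ?f ?g])
      show "stuffle_hom ?f" "stuffle_hom ?g"
        using f g stuffle_hom_rev[of "\<lambda>k. (-1) ^ length k * f k"]
          stuffle_hom_rev[of "\<lambda>k. (-1) ^ length k * g k"]
        unfolding Zstar_hom_iff by blast+
      show "?f [1] = ?g [1]"
        using f g by (simp add: Zstar_hom_def)
      show "?f k = ?g k" if "is_index k" "lead_ones k = 0" for k
      proof -
        have "admissible (rev k)"
          using that by (simp add: admissible_iff)
        then show ?thesis
          using f g unfolding Zstar_hom_iff by metis
      qed
    qed (use True in auto)
    then show ?thesis by simp
  qed (use f g in \<open>auto simp: Zstar_hom_def\<close>)
qed

text \<open>The reversed, sign-twisted \<open>reg_poly\<close> is a witness for
  \<open>Zstar_hom\<close>; with uniqueness, the definite description \<open>ZstarT\<close> has the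
  defining properties.\<close>

lemma stuffle_hom_zeta_star: "stuffle_hom zeta_star"
proof -
  let ?g = "\<lambda>k. (-1) ^ length k * reg_poly (rev k)"
  have sgn: "(-1) ^ length k * ?g k = reg_poly (rev k)" for k
    by (simp flip: mult.assoc power_add)
  have "?g k = 0" if "\<not> is_index k" for k
    using that by (simp add: reg_poly_def)
  then have hom: "Zstar_hom ?g"
    unfolding Zstar_hom_iff sgn
    using stuffle_hom_rev[OF stuffle_hom_reg_poly] reg_poly_admissible reg_poly_one by simp
  have "Zstar_hom ZstarT"
    unfolding ZstarT_def by (rule theI[of Zstar_hom, OF hom]) (rule Zstar_hom_unique[OF _ hom])
  moreover have "zeta_star = (\<lambda>k. (-1) ^ length k * ZstarT k)"
  proof
    show "zeta_star k = (-1) ^ length k * ZstarT k" for k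
      by (cases "even (length k)") (auto simp: zeta_star_def)
  qed
  ultimately show ?thesis
    by (simp add: Zstar_hom_iff)
qed

subsection \<open>The symmetric values\<close>

lemma emb_s_hom: "emb_s (x + y) = emb_s x + emb_s y" "emb_s (x * y) = emb_s x * emb_s y"
proof -
  have "[:\<Sum>i\<in>I. f i:] = (\<Sum>i\<in>I. [:f i:])" for f :: "nat \<Rightarrow> real poly" and I
    by (rule poly_eqI) (simp add: coeff_sum coeff_pCons split: nat.split)
  then show "emb_s (x + y) = emb_s x + emb_s y" "emb_s (x * y) = emb_s x * emb_s y"
    by (auto simp: emb_s_def fps_eq_iff fps_mult_nth mult.commute)
qed

lemma emb_t_hom: "emb_t (x + y) = emb_t x + emb_t y" "emb_t (x * y) = emb_t x * emb_t y"
proof -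
  let ?h = "map_poly (\<lambda>x::real. [:x:])"
  have add: "?h (p + q) = ?h p + ?h q" for p q
    by (rule poly_eqI) (simp add: coeff_map_poly)
  have sumc: "[:\<Sum>i\<in>I. f i:] = (\<Sum>i\<in>I. [:f i:])" for f :: "nat \<Rightarrow> real" and I
    by (rule poly_eqI) (simp add: coeff_sum coeff_pCons split: nat.split)
  have mult: "?h (p * q) = ?h p * ?h q" for p q
    by (rule poly_eqI) (simp add: coeff_map_poly coeff_mult sumc mult.commute)
  have sum: "fps_const (?h (\<Sum>i\<in>I. f i)) = (\<Sum>i\<in>I. fps_const (?h (f i)))" for f :: "nat \<Rightarrow> real poly" and I
    by (induction I rule: infinite_finite_induct) (auto simp: add simp flip: fps_const_add)
  show "emb_t (x + y) = emb_t x + emb_t y"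
    by (rule fps_ext) (simp add: emb_t_def add)
  show "emb_t (x * y) = emb_t x * emb_t y"
    by (rule fps_ext) (simp add: emb_t_def fps_mult_nth sum mult)
qed

text \<open>The defining sum is a convolution: the first factor is the \<open>s\<close>-shift, the
  second the reversed \<open>t\<close>-shift twisted by the sign of the weight.\<close>

lemma stuffle_hom_zeta_S_st:
  assumes "stuffle_hom zeta_star"
  shows "stuffle_hom zeta_S_st"
proof -
  have "zeta_S_st = convol (\<lambda>k. emb_s (shift_fps 1 k))
      (\<lambda>k. (-1) ^ wt k * emb_t (shift_fps (-1) (rev k)))"
    by (auto simp: fun_eq_iff zeta_S_st_def convol_def mult_ac)
  moreover have "stuffle_hom \<dots>"
    by (intro stuffle_hom_convol stuffle_hom_weight stuffle_hom_comp[of _ emb_s]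
      stuffle_hom_comp[of _ emb_t] stuffle_hom_rev stuffle_hom_shift_fps assms emb_s_hom emb_t_hom)
  ultimately show ?thesis by simp
qed

theorem theorem3p2:
  fixes k l :: "nat list"
  assumes "is_index k" and "is_index l"
  shows "lin_ext zeta_S_st (hprod_idx k l) = zeta_S_st k * zeta_S_st l"
  using stuffle_hom_zeta_S_st[OF stuffle_hom_zeta_star] assms
  by (simp add: lin_ext_hprod_idx stuffle_hom_def)

end
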